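(* Let $n,m\ge 1$ be integers, $p\in(0,1)$ and $q=1-p$. For $\pi\in S_n$ let $$\mathcal{B}(\pi):=\{B\subseteq [n-1]: \forall j \in \operatorname{Vl}(\pi),\ \{j-1, j\}\not\subseteq B\}.$$ Then for every $\pi\in S_n$, $$\nu_{n, m}^{(p)}(\pi) = \frac{1}{m^n}\sum_{B\in \mathcal{B}(\pi)}\binom{m}{n-|B|}\,p^{|\operatorname{Asc}(\pi)\cap B|}\,q^{|\operatorname{Des}(\pi)\cap B|}.$$
   Context: $(m,p)$-shelf shuffle: a deck of cards labelled $1,\ldots,n$, arranged in increasing order from top to bottom, is dealt sequentially from the bottom (so the cards are dealt in the order $n,n-1,\ldots,1$). Each card is assigned one of $m$ labelled shelves, independently and uniformly at random, and is placed at the top of the existing pile on that shelf with probability $p$ and at the bottom of it with probability $q=1-p$, independently of everything else (a card assigned to an empty shelf simply starts the pile). The shuffled deck is formed by joining the piles in the order of the shelves $1,\ldots,m$, and is read from top to bottom as a permutation $\pi=(\pi_1,\ldots,\pi_n)\in S_n$ in one-line notation ($\pi_i$ is the label of the card in position $i$). The law of this random permutation is denoted $\nu_{n,m}^{(p)}$. For $\pi\in S_n$ and $[n-1]=\{1,\ldots,n-1\}$: $\operatorname{Des}(\pi)=\{i\in[n-1]:\pi_i>\pi_{i+1}\}$, $\operatorname{Asc}(\pi)=[n-1]\setminus\operatorname{Des}(\pi)$, $\operatorname{Vl}(\pi)=\{2\le i\le n-1:\pi_{i-1}>\pi_i<\pi_{i+1}\}$. $\binom{m}{k}=0$ if $k>m$.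 *)

theory Defs
  imports "HOL-Probability.Probability" "HOL-Combinatorics.Permutations"
begin

text \<open>Decks and piles are lists read from top to bottom; \<open>piles s\<close> is the pile on shelf \<open>s\<close>.
  The list argument of \<open>deal\<close> holds the cards still to be dealt, in the order in which they are
  dealt. The monadic bind draws a fresh shelf and a fresh coin for every card, independently of
  everything drawn before.\<close>

primrec deal ::
  "nat \<Rightarrow> real \<Rightarrow> nat list \<Rightarrow> (nat \<Rightarrow> nat list) \<Rightarrow> (nat \<Rightarrow> nat list) pmf" where
  "deal m p [] piles = return_pmf piles"
| "deal m p (c # cs) piles =
     do {
       s \<leftarrow> pmf_of_set {1..m};
       on_top \<leftarrow> bernoulli_pmf p;
       deal m p cs (piles(s := (if on_top then c # piles s else piles s @ [c])))
     }"

definition join_piles :: "nat \<Rightarrow> (nat \<Rightarrow> nat list) \<Rightarrow> nat list" where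
  "join_piles m piles = concat (map piles [1..<Suc m])"

definition shelf_shuffle :: "nat \<Rightarrow> real \<Rightarrow> nat list \<Rightarrow> nat list pmf" where
  "shelf_shuffle m p deck = map_pmf (join_piles m) (deal m p (rev deck) (\<lambda>_. []))"

text \<open>A permutation in \<open>S\<^sub>n\<close> is a function on \<open>nat\<close> that permutes \<open>{1..n}\<close>, and hence is the
  identity outside of \<open>{1..n}\<close>. Positions in a deck are counted from 1.\<close>

definition perm_of_deck :: "nat list \<Rightarrow> (nat \<Rightarrow> nat)" where
  "perm_of_deck deck = (\<lambda>i. if i \<in> {1..length deck} then deck ! (i - 1) else i)"

definition shelf_law :: "nat \<Rightarrow> nat \<Rightarrow> real \<Rightarrow> (nat \<Rightarrow> nat) pmf" where
  "shelf_law n m p = map_pmf perm_of_deck (shelf_shuffle m p [1..<Suc n])"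

definition Des :: "nat \<Rightarrow> (nat \<Rightarrow> nat) \<Rightarrow> nat set" where
  "Des n \<pi> = {i \<in> {1..n - 1}. \<pi> i > \<pi> (i + 1)}"

definition Asc :: "nat \<Rightarrow> (nat \<Rightarrow> nat) \<Rightarrow> nat set" where
  "Asc n \<pi> = {1..n - 1} - Des n \<pi>"

definition Vl :: "nat \<Rightarrow> (nat \<Rightarrow> nat) \<Rightarrow> nat set" where
  "Vl n \<pi> = {i \<in> {2..n - 1}. \<pi> (i - 1) > \<pi> i \<and> \<pi> i < \<pi> (i + 1)}"

definition valley_free :: "nat \<Rightarrow> (nat \<Rightarrow> nat) \<Rightarrow> nat set set" where
  "valley_free n \<pi> = {B. B \<subseteq> {1..n - 1} \<and> (\<forall>j \<in> Vl n \<pi>. \<not> {j - 1, j} \<subseteq> B)}"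

end

theory Submission
  imports Defs
begin

text \<open>
  The cards are dealt from the largest to the smallest, so every new card goes to an end of a pile
  all of whose cards are larger. A pile is therefore a unimodal word, first ascending and then
  descending, and it records how it came about: reading the history backwards, the smallest card
  lies either on top, at the start of an ascent (probability \<open>p\<close>), or at the bottom, at the end
  of a descent (probability \<open>q\<close>). Only the first card of a pile leaves no trace of its coin, and
  it contributes \<open>p + q = 1\<close>. Hence the configuration with piles \<open>F 1, \<dots>, F m\<close> has probability
  \<open>m\<^sup>-\<^sup>n\<close> times the product of the weights of the piles, where a unimodal word has weight
  \<open>p\<close> to the number of its ascents times \<open>q\<close> to the number of its descents, and a word with
  a valley has weight \<open>0\<close>. This is \<open>pmf_deal\<close>.

  The probability of \<open>\<pi>\<close> is then the sum of this product over all ways of cutting the word of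
  \<open>\<pi>\<close> into \<open>m\<close> consecutive blocks, empty ones allowed. Let \<open>B\<close> be the set of the positions
  \<open>i\<close> such that \<open>i\<close> and \<open>i + 1\<close> are in the same block. There are \<open>n - |B|\<close> nonempty blocks,
  so \<open>B\<close> arises from \<open>m choose (n - |B|)\<close> cuttings, one for each choice of the nonempty shelves.
  The product of the block weights depends only on \<open>B\<close>: an element of \<open>B\<close> contributes \<open>p\<close> or
  \<open>q\<close> as it is an ascent or a descent, and the product vanishes iff a valley \<open>j\<close> is interior to
  a block, that is, \<open>j - 1\<close> and \<open>j\<close> are both in \<open>B\<close>. The count of the cuttings is carried out
  in \<open>sum_splits_eq_sum_links\<close> by induction on \<open>m\<close>: splitting off the last shelf turns into
  Pascal's rule for the binomial coefficients.
\<close>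

section \<open>The weight of a pile\<close>

text \<open>For words with distinct letters this is \<open>p\<close> to the number of ascents times \<open>q\<close> to the
  number of descents, and \<open>0\<close> as soon as some descent is followed by an ascent. Valleys are
  tested one letter ahead, which makes the weight a product of local factors.\<close>

fun pile_weight :: "real \<Rightarrow> real \<Rightarrow> nat list \<Rightarrow> real" where
  "pile_weight p q [] = 1"
| "pile_weight p q [x] = 1"
| "pile_weight p q (x # y # zs) =
     (if x < y then p else if zs \<noteq> [] \<and> y < hd zs then 0 else q) * pile_weight p q (y # zs)"

text \<open>These rules describe how the weight of a pile changes when its smallest card is removed.
  They mirror the last step of the dealing: a smallest card on top starts an ascent, one at the
  bottom ends a descent, and one in the interior is a valley.\<close>

lemma pile_weight_Cons_least:
  assumes "\<forall>x \<in> set xs. c < x" "xs \<noteq> []"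
  shows "pile_weight p q (c # xs) = p * pile_weight p q xs"
  using assms by (cases xs) auto

lemma pile_weight_snoc_least:
  assumes "\<forall>x \<in> set xs. c < x" "xs \<noteq> []"
  shows "pile_weight p q (xs @ [c]) = q * pile_weight p q xs"
  using assms
proof (induction p q xs rule: pile_weight.induct)
  case (3 p q x y zs)
  then show ?case by (cases zs) auto
qed auto

lemma pile_weight_inner_least:
  assumes "\<forall>x \<in> set us \<union> set vs. c < x" "us \<noteq> []" "vs \<noteq> []"
  shows "pile_weight p q (us @ c # vs) = 0"
  using assms
proof (induction us rule: induct_list012)
  case (2 u)
  then show ?case by (cases vs) auto
qed auto

section \<open>The law of the piles\<close>

definition place :: "nat \<Rightarrow> nat \<Rightarrow> bool \<Rightarrow> (nat \<Rightarrow> nat list) \<Rightarrow> (nat \<Rightarrow> nat list)" where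
  "place c s on_top piles = piles(s := (if on_top then c # piles s else piles s @ [c]))"

text \<open>The recursion of \<open>deal\<close> peels off the first card, but the weights are governed by the
  last, smallest card. Its shelf and coin are independent of everything before, so they may be
  drawn first.\<close>

lemma deal_snoc:
  "deal m p (cs @ [c]) piles =
     do {
       s \<leftarrow> pmf_of_set {1..m};
       on_top \<leftarrow> bernoulli_pmf p;
       map_pmf (place c s on_top) (deal m p cs piles)
     }"
proof -
  have "deal m p (cs @ [c]) piles =
     do {
       F \<leftarrow> deal m p cs piles;
       s \<leftarrow> pmf_of_set {1..m};
       on_top \<leftarrow> bernoulli_pmf p;
       return_pmf (place c s on_top F)
     }"
    by (induction cs arbitrary: piles) (auto simp: bind_assoc_pmf bind_return_pmf place_def)
  also have "\<dots> = do {
       s \<leftarrow> pmf_of_set {1..m};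
       F \<leftarrow> deal m p cs piles;
       on_top \<leftarrow> bernoulli_pmf p;
       return_pmf (place c s on_top F)
     }"
    by (rule bind_commute_pmf)
  also have "\<dots> = do {
       s \<leftarrow> pmf_of_set {1..m};
       on_top \<leftarrow> bernoulli_pmf p;
       F \<leftarrow> deal m p cs piles;
       return_pmf (place c s on_top F)
     }"
    by (subst bind_commute_pmf) (rule refl)
  finally show ?thesis by (simp add: map_pmf_def)
qed

lemma pmf_deal_snoc:
  assumes "m \<ge> 1" "0 \<le> p" "p \<le> 1"
  shows "pmf (deal m p (cs @ [c]) piles) F =
    1 / real m * (\<Sum>s \<in> {1..m}.
      p * pmf (map_pmf (place c s True) (deal m p cs piles)) F +
      (1 - p) * pmf (map_pmf (place c s False) (deal m p cs piles)) F)"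
  unfolding deal_snoc using assms
  by (simp add: pmf_bind integral_pmf_of_set mult.commute)

text \<open>For a fixed shelf and a fixed coin, placing a card is injective, so the configuration before
  the last card is determined by the one after it.\<close>

lemma pmf_map_place_top:
  "pmf (map_pmf (place c s True) D) F =
    (if F s \<noteq> [] \<and> hd (F s) = c then pmf D (F(s := tl (F s))) else 0)"
proof (cases "F s \<noteq> [] \<and> hd (F s) = c")
  case True
  have "inj (place c s True)"
  proof (intro injI ext)
    fix G H x assume "place c s True G = place c s True H"
    from fun_cong[OF this, of x] show "G x = H x" by (simp add: place_def split: if_splits)
  qed
  moreover have "F = place c s True (F(s := tl (F s)))"
    using True by (auto simp: place_def fun_eq_iff)
  ultimately show ?thesis using True by (metis pmf_map_inj')
next
  case False
  then have "F \<notin> range (place c s True)" by (auto simp: place_def)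
  then show ?thesis using False by (subst pmf_map_outside) auto
qed

lemma pmf_map_place_bottom:
  "pmf (map_pmf (place c s False) D) F =
    (if F s \<noteq> [] \<and> last (F s) = c then pmf D (F(s := butlast (F s))) else 0)"
proof (cases "F s \<noteq> [] \<and> last (F s) = c")
  case True
  have "inj (place c s False)"
  proof (intro injI ext)
    fix G H x assume "place c s False G = place c s False H"
    from fun_cong[OF this, of x] show "G x = H x" by (simp add: place_def split: if_splits)
  qed
  moreover have "F = place c s False (F(s := butlast (F s)))"
    using True by (auto simp: place_def fun_eq_iff)
  ultimately show ?thesis using True by (metis pmf_map_inj')
next
  case False
  then have "F \<notin> range (place c s False)" by (auto simp: place_def)
  then show ?thesis using False by (subst pmf_map_outside) auto
qed

text \<open>By induction on the number of cards dealt. In the step, the smallest card \<open>c\<close> is on exactly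
  one shelf \<open>t\<close>, so only this shelf contributes to the sum over the shelves. If \<open>c\<close> is alone on
  it, both coins lead to \<open>F\<close>, and \<open>p + (1 - p) = 1\<close> is the weight of a single card.\<close>

lemma pmf_deal:
  assumes "m \<ge> 1" "0 \<le> p" "p \<le> 1" "sorted_wrt (>) cs"
    and "(\<Sum>s \<in> {1..m}. mset (F s)) = mset cs" "\<forall>s. s \<notin> {1..m} \<longrightarrow> F s = []"
  shows "pmf (deal m p cs (\<lambda>_. [])) F =
    (1 / real m) ^ length cs * (\<Prod>s \<in> {1..m}. pile_weight p (1 - p) (F s))"
  using assms(4-6)
proof (induction cs arbitrary: F rule: rev_induct)
  case Nil
  have "F s = []" for s
  proof (cases "s \<in> {1..m}")
    case True
    then show ?thesis using arg_cong[OF Nil.prems(2), of set_mset] by (auto simp: set_mset_sum)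
  qed (use Nil.prems(3) in simp)
  then have "F = (\<lambda>_. [])" by blast
  then show ?case by simp
next
  case (snoc c cs)
  let ?D = "deal m p cs (\<lambda>_. [])" and ?W = "pile_weight p (1 - p)"
  have "c \<in># (\<Sum>s \<in> {1..m}. mset (F s))" using snoc.prems(2) by simp
  then obtain t where t: "t \<in> {1..m}" "c \<in> set (F t)"
    by (auto simp: set_mset_sum)
  obtain us vs where uv: "F t = us @ c # vs" using t(2) by (meson split_list)
  \<comment> \<open>the cards on the other shelves\<close>
  define M where "M = (\<Sum>s \<in> {1..m} - {t}. mset (F s))"
  have M: "mset us + mset vs + M = mset cs"
    using snoc.prems(2) t(1) by (simp add: sum.remove[of _ t] uv M_def)
  have gt: "\<forall>x \<in> set cs. c < x" using snoc.prems(1) by (auto simp: sorted_wrt_append)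
  have set_cs: "set us \<union> set vs \<union> set_mset M = set cs"
    using arg_cong[OF M, of set_mset] by simp
  have gt_uv: "\<forall>x \<in> set us \<union> set vs. c < x" using gt set_cs by blast
  have "c \<notin># M" using gt set_cs by blast
  then have c_only: "c \<notin> set (F s)" if "s \<in> {1..m}" "s \<noteq> t" for s
    using that by (auto simp: M_def set_mset_sum)
  define R where "R = (\<Prod>s \<in> {1..m} - {t}. ?W (F s))"
  have prev: "pmf ?D (F(t := us @ vs)) = (1 / real m) ^ length cs * (?W (us @ vs) * R)"
  proof -
    have "(\<Sum>s \<in> {1..m}. mset ((F(t := us @ vs)) s)) = mset cs"
      using t(1) M by (simp add: sum.remove[of _ t] M_def)
    moreover have "(\<Prod>s \<in> {1..m}. ?W ((F(t := us @ vs)) s)) = ?W (us @ vs) * R"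
      using t(1) by (simp add: prod.remove[of _ t] R_def)
    moreover have "\<forall>s. s \<notin> {1..m} \<longrightarrow> (F(t := us @ vs)) s = []"
      using snoc.prems(3) t(1) by auto
    moreover have "sorted_wrt (>) cs"
      using snoc.prems(1) by (simp add: sorted_wrt_append)
    ultimately show ?thesis by (simp only: snoc.IH)
  qed
  let ?term = "\<lambda>s. p * pmf (map_pmf (place c s True) ?D) F +
      (1 - p) * pmf (map_pmf (place c s False) ?D) F"
  have "?term s = 0" if "s \<in> {1..m} - {t}" for s
    using c_only[of s] that hd_in_set[of "F s"] last_in_set[of "F s"]
    by (auto simp: pmf_map_place_top pmf_map_place_bottom)
  then have "(\<Sum>s \<in> {1..m}. ?term s) = ?term t"
    using t(1) by (simp add: sum.remove[of _ t])
  also have "\<dots> = (1 / real m) ^ length cs * (?W (F t) * R)"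
  proof -
    have top: "pmf (map_pmf (place c t True) ?D) F = (if us = [] then pmf ?D (F(t := us @ vs)) else 0)"
      using gt_uv by (auto simp: pmf_map_place_top uv hd_append)
    have bottom: "pmf (map_pmf (place c t False) ?D) F = (if vs = [] then pmf ?D (F(t := us @ vs)) else 0)"
      using gt_uv by (auto simp: pmf_map_place_bottom uv butlast_append)
    show ?thesis
      unfolding top bottom prev uv
      using gt_uv pile_weight_Cons_least[of vs c p "1 - p"] pile_weight_snoc_least[of us c p "1 - p"]
        pile_weight_inner_least[of us vs c p "1 - p"]
      by (cases "us = []"; cases "vs = []"; simp; simp add: algebra_simps)
  qed
  also have "?W (F t) * R = (\<Prod>s \<in> {1..m}. ?W (F s))"
    using t(1) by (simp add: prod.remove[of _ t] R_def)
  finally show ?case using assms(1-3) by (simp add: pmf_deal_snoc)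
qed

section \<open>Cutting a word into consecutive blocks\<close>

definition splits :: "nat \<Rightarrow> nat list \<Rightarrow> (nat \<Rightarrow> nat list) set" where
  "splits m xs = {F. (\<forall>s. s \<notin> {1..m} \<longrightarrow> F s = []) \<and> join_piles m F = xs}"

lemma length_join_piles: "length (join_piles m F) = (\<Sum>s \<in> {1..m}. length (F s))"
  by (induction m) (simp_all add: join_piles_def)

lemma mset_join_piles: "mset (join_piles m F) = (\<Sum>s \<in> {1..m}. mset (F s))"
  by (induction m) (simp_all add: join_piles_def)

lemma join_piles_cong: "(\<And>s. s \<in> {1..m} \<Longrightarrow> F s = G s) \<Longrightarrow> join_piles m F = join_piles m G"
  unfolding join_piles_def by (intro arg_cong[of _ _ concat] map_cong) auto

lemma join_piles_Suc: "join_piles (Suc m) F = join_piles m F @ F (Suc m)"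
  by (simp add: join_piles_def)

text \<open>Bounds the support of the law: no pile lies off the shelves and no card is lost, so the final
  deck has as many cards as were dealt.\<close>

lemma set_pmf_deal:
  assumes "m \<ge> 1" "F \<in> set_pmf (deal m p cs piles)"
  shows "(\<forall>s. s \<notin> {1..m} \<longrightarrow> F s = piles s) \<and>
    length (join_piles m F) = length cs + length (join_piles m piles)"
  using assms(2)
proof (induction cs arbitrary: piles)
  case (Cons c cs)
  from Cons.prems assms(1) obtain s b where s: "s \<in> {1..m}"
    and F: "F \<in> set_pmf (deal m p cs (place c s b piles))"
    unfolding deal.simps place_def by (fastforce simp: set_bind_pmf)
  have "length (join_piles m (place c s b piles)) = Suc (length (join_piles m piles))"
    using s by (simp add: length_join_piles place_def sum.remove[of _ s])
  moreover have "place c s b piles t = piles t" if "t \<notin> {1..m}" for t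
    using that s by (auto simp: place_def)
  ultimately show ?case using Cons.IH[OF F] by simp
qed simp

text \<open>The last pile is a suffix of the word. The cutting of \<open>xs\<close> is determined by the length \<open>k\<close>
  of the rest and by the cutting of this prefix into one block less.\<close>

lemma splits_Suc:
  "bij_betw (\<lambda>(k, F). F(Suc m := drop k xs)) (SIGMA k : {..length xs}. splits m (take k xs))
     (splits (Suc m) xs)"
proof (rule bij_betw_byWitness[where f' = "\<lambda>G. (length xs - length (G (Suc m)), G(Suc m := []))"])
  show "\<forall>kF \<in> (SIGMA k : {..length xs}. splits m (take k xs)).
      (\<lambda>G. (length xs - length (G (Suc m)), G(Suc m := []))) ((\<lambda>(k, F). F(Suc m := drop k xs)) kF) = kF"
    by (auto simp: splits_def fun_eq_iff)
  have rest: "join_piles m (G(Suc m := zs)) = join_piles m G" for G zs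
    by (rule join_piles_cong) auto
  show "\<forall>G \<in> splits (Suc m) xs.
      (\<lambda>(k, F). F(Suc m := drop k xs)) (length xs - length (G (Suc m)), G(Suc m := [])) = G"
    by (auto simp: splits_def fun_eq_iff join_piles_Suc)
  show "(\<lambda>(k, F). F(Suc m := drop k xs)) ` (SIGMA k : {..length xs}. splits m (take k xs))
      \<subseteq> splits (Suc m) xs"
    by (auto simp: splits_def join_piles_Suc rest)
  show "(\<lambda>G. (length xs - length (G (Suc m)), G(Suc m := []))) ` splits (Suc m) xs
      \<subseteq> (SIGMA k : {..length xs}. splits m (take k xs))"
    by (auto simp: splits_def join_piles_Suc rest)
qed

lemma splits_0: "splits 0 xs = (if xs = [] then {\<lambda>_. []} else {})"
  by (auto simp: splits_def join_piles_def)

lemma finite_splits: "finite (splits m xs)"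
proof (induction m arbitrary: xs)
  case (Suc m)
  then show ?case using bij_betw_finite[OF splits_Suc[of m xs]] by simp
qed (simp add: splits_0)

lemma sum_splits_Suc:
  "(\<Sum>F \<in> splits (Suc m) xs. \<Prod>s \<in> {1..Suc m}. w (F s)) =
   (\<Sum>k \<le> length xs. (\<Sum>F \<in> splits m (take k xs). \<Prod>s \<in> {1..m}. w (F s)) * (w (drop k xs) :: real))"
proof -
  have "(\<Sum>F \<in> splits (Suc m) xs. \<Prod>s \<in> {1..Suc m}. w (F s)) =
    (\<Sum>(k, F) \<in> (SIGMA k : {..length xs}. splits m (take k xs)).
       \<Prod>s \<in> {1..Suc m}. w ((F(Suc m := drop k xs)) s))"
    by (subst sum.reindex_bij_betw[OF splits_Suc, symmetric]) (simp add: case_prod_unfold)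
  also have "\<dots> = (\<Sum>(k, F) \<in> (SIGMA k : {..length xs}. splits m (take k xs)).
       (\<Prod>s \<in> {1..m}. w (F s)) * w (drop k xs))"
    by (intro sum.cong refl) auto
  also have "\<dots> = (\<Sum>k \<le> length xs. \<Sum>F \<in> splits m (take k xs). (\<Prod>s \<in> {1..m}. w (F s)) * w (drop k xs))"
    by (rule sum.Sigma[symmetric]) (simp_all add: finite_splits)
  finally show ?thesis by (simp add: sum_distrib_right)
qed

section \<open>Sets of linked positions\<close>

text \<open>The counterpart of splitting off the last block: \<open>i\<close> is the last position before \<open>j\<close>
  outside of the set. The value \<open>i = 0\<close>, which belongs to no set considered, occurs when the set
  is all of \<open>{1..<j}\<close>.\<close>

lemma sum_Pow_last_gap:
  fixes g :: "nat set \<Rightarrow> real"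
  assumes "j \<ge> 1"
  shows "(\<Sum>B \<in> Pow {1..<j}. g B) = (\<Sum>i<j. \<Sum>B \<in> Pow {1..<i}. g (B \<union> {i + 1..<j}))"
  using assms
proof (induction j arbitrary: g rule: nat_induct_at_least)
  case base
  then show ?case by simp
next
  case (Suc j)
  have "{1..<Suc j} = insert j {1..<j}" using Suc.hyps by auto
  then have "Pow {1..<Suc j} = Pow {1..<j} \<union> insert j ` Pow {1..<j}" by (simp add: Pow_insert)
  then have "(\<Sum>B \<in> Pow {1..<Suc j}. g B) = (\<Sum>B \<in> Pow {1..<j}. g B) + (\<Sum>B \<in> insert j ` Pow {1..<j}. g B)"
    by (simp only:, subst sum.union_disjoint) auto
  also have "(\<Sum>B \<in> insert j ` Pow {1..<j}. g B) = (\<Sum>B \<in> Pow {1..<j}. g (insert j B))"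
  proof (rule sum.reindex[unfolded comp_def], rule inj_onI)
    fix x y assume xy: "x \<in> Pow {1..<j}" "y \<in> Pow {1..<j}" and eq: "insert j x = insert j y"
    from xy have "j \<notin> x" "j \<notin> y" by auto
    with eq show "x = y" by (metis insert_ident)
  qed
  also have "\<dots> = (\<Sum>i<j. \<Sum>B \<in> Pow {1..<i}. g (B \<union> {i + 1..<Suc j}))"
    by (subst Suc.IH) (auto intro!: sum.cong arg_cong[of _ _ g])
  finally show ?case by simp
qed

text \<open>The weight of a set \<open>B\<close> of positions, where \<open>i \<in> B\<close> means that \<open>\<pi> i\<close> and \<open>\<pi> (i + 1)\<close>
  are linked, that is, lie in the same block.\<close>

definition link_weight :: "nat \<Rightarrow> (nat \<Rightarrow> nat) \<Rightarrow> real \<Rightarrow> real \<Rightarrow> nat set \<Rightarrow> real" where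
  "link_weight n \<pi> p q B = (if \<exists>j \<in> Vl n \<pi>. {j - 1, j} \<subseteq> B then 0
     else p ^ card (Asc n \<pi> \<inter> B) * q ^ card (Des n \<pi> \<inter> B))"

lemma finite_Asc [simp]: "finite (Asc n \<pi>)" and finite_Des [simp]: "finite (Des n \<pi>)"
  by (simp_all add: Asc_def Des_def)

text \<open>A gap at \<open>i\<close> separates the blocks on its two sides: a valley \<open>j\<close> with \<open>j - 1\<close> and \<open>j\<close> in
  the union must have both of them on the same side.\<close>

lemma link_weight_Un:
  assumes "B \<subseteq> {1..<i}" "C \<subseteq> {i<..}"
  shows "link_weight n \<pi> p q (B \<union> C) = link_weight n \<pi> p q B * link_weight n \<pi> p q C"
proof -
  have "{j - 1, j} \<subseteq> B \<union> C \<longleftrightarrow> {j - 1, j} \<subseteq> B \<or> {j - 1, j} \<subseteq> C" for j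
    using assms by (fastforce simp: subset_iff)
  then have "(\<exists>j \<in> Vl n \<pi>. {j - 1, j} \<subseteq> B \<union> C) \<longleftrightarrow>
      (\<exists>j \<in> Vl n \<pi>. {j - 1, j} \<subseteq> B) \<or> (\<exists>j \<in> Vl n \<pi>. {j - 1, j} \<subseteq> C)" by blast
  moreover have "card (A \<inter> (B \<union> C)) = card (A \<inter> B) + card (A \<inter> C)" if "finite A" for A
    using assms that unfolding Int_Un_distrib by (subst card_Un_disjoint) fastforce+
  ultimately show ?thesis by (auto simp: link_weight_def power_add)
qed

lemma link_weight_empty [simp]: "link_weight n \<pi> p q {} = 1"
  by (simp add: link_weight_def)

text \<open>The new first position \<open>i\<close> can complete only the forbidden pair of a valley at \<open>i + 1\<close>,
  and such a valley requires \<open>i\<close> to be a descent. This gives the same local factor as in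
  \<open>pile_weight\<close>.\<close>

lemma link_weight_insert:
  assumes "1 \<le> i" "i < n" "C \<subseteq> {i<..}"
  shows "link_weight n \<pi> p q (insert i C) =
    (if \<pi> i > \<pi> (i + 1) then (if i + 1 \<in> C \<and> i + 1 \<in> Vl n \<pi> then 0 else q) else p) * link_weight n \<pi> p q C"
proof -
  have i: "i \<notin> C" "i - 1 \<notin> C" using assms by auto
  have "{j - 1, j} \<subseteq> insert i C \<longleftrightarrow> {j - 1, j} \<subseteq> C \<or> j = i + 1 \<and> i + 1 \<in> C" if "j \<in> Vl n \<pi>" for j
    using that i assms(1) by (auto simp: Vl_def)
  then have valley: "(\<exists>j \<in> Vl n \<pi>. {j - 1, j} \<subseteq> insert i C) \<longleftrightarrow>
      (\<exists>j \<in> Vl n \<pi>. {j - 1, j} \<subseteq> C) \<or> i + 1 \<in> C \<and> i + 1 \<in> Vl n \<pi>" by blast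
  have card_if: "card (A \<inter> insert i C) = (if i \<in> A then Suc (card (A \<inter> C)) else card (A \<inter> C))"
    if "finite A" for A
    using that i by auto
  have "i \<in> Des n \<pi> \<longleftrightarrow> \<pi> i > \<pi> (i + 1)" "i \<in> Asc n \<pi> \<longleftrightarrow> \<not> \<pi> i > \<pi> (i + 1)"
    using assms by (auto simp: Asc_def Des_def)
  moreover have "\<pi> i > \<pi> (i + 1)" if "i + 1 \<in> Vl n \<pi>" using that by (simp add: Vl_def)
  ultimately show ?thesis
    unfolding link_weight_def valley card_if[OF finite_Asc] card_if[OF finite_Des] by auto
qed

text \<open>The two weights agree on the block occupying the positions \<open>i + 1, \<dots>, j\<close>: both are peeled
  off from the left, one letter and one link at a time. Injectivity of \<open>\<pi>\<close> excludes ties, which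
  \<open>pile_weight\<close> and \<open>Des\<close> would treat differently.\<close>

lemma pile_weight_block:
  assumes "inj_on \<pi> {1..n}" "i < j" "j \<le> n"
  shows "pile_weight p q (map \<pi> [i + 1..<j + 1]) = link_weight n \<pi> p q {i + 1..<j}"
  using assms(2,3)
proof (induction "j - i" arbitrary: i rule: less_induct)
  case less
  show ?case
  proof (cases "j = i + 1")
    case True
    then show ?thesis by simp
  next
    case False
    then have j: "i + 2 \<le> j" using less.prems by simp
    define R where "R = [i + 3..<j + 1]"
    have upt: "[i + 1..<j + 1] = (i + 1) # [i + 2..<j + 1]" "[i + 2..<j + 1] = (i + 2) # R"
      using upt_conv_Cons[of "i + 1" "j + 1"] upt_conv_Cons[of "i + 2" "j + 1"] j
      by (simp_all add: R_def numeral_3_eq_3 del: upt_Suc)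
    have ne: "\<pi> (i + 1) \<noteq> \<pi> (i + 2)"
      using inj_onD[OF assms(1), of "i + 1" "i + 2"] j less.prems by auto
    have hd: "map \<pi> R \<noteq> [] \<and> \<pi> (i + 2) < hd (map \<pi> R) \<longleftrightarrow> i + 2 \<in> {i + 2..<j} \<and> \<pi> (i + 2) < \<pi> (i + 3)"
    proof (cases "i + 3 < j + 1")
      case True
      have "R = (i + 3) # [Suc (i + 3)..<j + 1]" unfolding R_def by (rule upt_conv_Cons[OF True])
      then show ?thesis using True by simp
    next
      case False
      then have "R = []" unfolding R_def by simp
      then show ?thesis using False by simp
    qed
    have ins: "{i + 1..<j} = insert (i + 1) {i + 2..<j}" using j by auto
    have "pile_weight p q (map \<pi> [i + 1..<j + 1]) =
      (if \<pi> (i + 1) < \<pi> (i + 2) then p else if i + 2 \<in> {i + 2..<j} \<and> \<pi> (i + 2) < \<pi> (i + 3) then 0 else q)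
       * pile_weight p q (map \<pi> [i + 2..<j + 1])"
      unfolding upt list.map pile_weight.simps hd by (rule refl)
    also have "pile_weight p q (map \<pi> [i + 2..<j + 1]) = link_weight n \<pi> p q {i + 2..<j}"
      using less.hyps[of "i + 1"] less.prems j by simp
    also have "(if \<pi> (i + 1) < \<pi> (i + 2) then p else if i + 2 \<in> {i + 2..<j} \<and> \<pi> (i + 2) < \<pi> (i + 3) then 0 else q)
      * link_weight n \<pi> p q {i + 2..<j} = link_weight n \<pi> p q {i + 1..<j}"
      unfolding ins using less.prems j ne
      by (subst link_weight_insert) (auto simp: Vl_def numeral_2_eq_2 numeral_3_eq_3)
    finally show ?thesis .
  qed
qed

section \<open>Counting the cuttings\<close>

text \<open>Induction on \<open>m\<close>, splitting off the last shelf. If it is empty, the word is cut into the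
  other \<open>m\<close> blocks. If it holds the positions \<open>k + 1, \<dots>, j\<close>, then \<open>k\<close> is the last gap of the
  set of links, and one nonempty block fewer remains for the other shelves. For a set \<open>B\<close> the
  binomial coefficients of the two cases, with lower indices \<open>j - |B|\<close> and \<open>j - |B| - 1\<close>, add
  up by Pascal's rule.\<close>

lemma sum_splits_eq_sum_links:
  assumes "inj_on \<pi> {1..n}" "j \<le> n"
  shows "(\<Sum>F \<in> splits m (map \<pi> [1..<j + 1]). \<Prod>s \<in> {1..m}. pile_weight p q (F s)) =
    (\<Sum>B \<in> Pow {1..<j}. real (m choose (j - card B)) * link_weight n \<pi> p q B)"
  using assms(2)
proof (induction m arbitrary: j)
  case 0
  have "0 choose (j - card B) = 0" if "B \<in> Pow {1..<j}" "j > 0" for B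
    using that card_mono[of "{1..<j}" B] by (intro binomial_eq_0) simp
  then show ?case by (cases "j = 0") (auto simp: splits_0 intro!: sum.neutral)
next
  case (Suc m)
  let ?T = "\<lambda>m j. \<Sum>B \<in> Pow {1..<j}. real (m choose (j - card B)) * link_weight n \<pi> p q B"
  have take: "take k (map \<pi> [1..<j + 1]) = map \<pi> [1..<k + 1]" if "k \<le> j" for k
    using that by (simp add: take_map take_upt del: upt_Suc)
  have drop: "drop k (map \<pi> [1..<j + 1]) = map \<pi> [k + 1..<j + 1]" for k
    by (simp add: drop_map del: upt_Suc)
  have "(\<Sum>F \<in> splits (Suc m) (map \<pi> [1..<j + 1]). \<Prod>s \<in> {1..Suc m}. pile_weight p q (F s)) =
    (\<Sum>k \<le> j. ?T m k * pile_weight p q (map \<pi> [k + 1..<j + 1]))"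
    unfolding sum_splits_Suc drop
  proof (rule sum.cong)
    fix k assume "k \<in> {..j}"
    then have "k \<le> j" "k \<le> n" using Suc.prems by auto
    then show "(\<Sum>F \<in> splits m (take k (map \<pi> [1..<j + 1])). \<Prod>s \<in> {1..m}. pile_weight p q (F s)) *
      pile_weight p q (map \<pi> [k + 1..<j + 1]) = ?T m k * pile_weight p q (map \<pi> [k + 1..<j + 1])"
      by (simp only: take Suc.IH)
  qed simp
  also have "\<dots> = ?T m j + (\<Sum>k<j. ?T m k * link_weight n \<pi> p q {k + 1..<j})"
    using pile_weight_block[OF assms(1)] Suc.prems
    by (simp add: lessThan_Suc_atMost[symmetric])
  also have "\<dots> = ?T (Suc m) j"
  proof (cases "j = 0")
    case False
    define g where "g B = real (m choose (j - card B - 1)) * link_weight n \<pi> p q B" for B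
    have "(\<Sum>k<j. ?T m k * link_weight n \<pi> p q {k + 1..<j}) =
      (\<Sum>k<j. \<Sum>B \<in> Pow {1..<k}. g (B \<union> {k + 1..<j}))"
    proof (intro sum.cong refl, subst sum_distrib_right, intro sum.cong refl)
      fix k B assume k: "k \<in> {..<j}" and B: "B \<in> Pow {1..<k}"
      have "card (B \<union> {k + 1..<j}) = card B + (j - (k + 1))"
        using B by (subst card_Un_disjoint) (auto intro: finite_subset)
      then have "j - card (B \<union> {k + 1..<j}) - 1 = k - card B" using k by simp
      moreover have "link_weight n \<pi> p q (B \<union> {k + 1..<j}) =
          link_weight n \<pi> p q B * link_weight n \<pi> p q {k + 1..<j}"
        using B by (intro link_weight_Un[of _ k]) auto
      ultimately show "real (m choose (k - card B)) * link_weight n \<pi> p q B * link_weight n \<pi> p q {k + 1..<j} =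
          g (B \<union> {k + 1..<j})"
        by (simp add: g_def)
    qed
    also have "\<dots> = (\<Sum>B \<in> Pow {1..<j}. g B)"
      by (rule sum_Pow_last_gap[symmetric]) (use False in simp)
    finally have "(\<Sum>k<j. ?T m k * link_weight n \<pi> p q {k + 1..<j}) = (\<Sum>B \<in> Pow {1..<j}. g B)" .
    then have "?T m j + (\<Sum>k<j. ?T m k * link_weight n \<pi> p q {k + 1..<j}) =
      (\<Sum>B \<in> Pow {1..<j}. (real (m choose (j - card B)) + real (m choose (j - card B - 1)))
         * link_weight n \<pi> p q B)"
      by (simp add: g_def sum.distrib distrib_right)
    also have "\<dots> = ?T (Suc m) j"
    proof (intro sum.cong refl)
      fix B assume "B \<in> Pow {1..<j}"
      then have "card B < j" using card_mono[of "{1..<j}" B] False by simp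
      then obtain r where "j - card B = Suc r" by (metis Suc_diff_Suc)
      \<comment> \<open>a nonempty word has at least one block, so Pascal's rule applies\<close>
      then show "(real (m choose (j - card B)) + real (m choose (j - card B - 1))) * link_weight n \<pi> p q B =
        real (Suc m choose (j - card B)) * link_weight n \<pi> p q B" by simp
    qed
    finally show ?thesis .
  qed simp
  finally show ?case .
qed

section \<open>The law of the shelf shuffle\<close>

lemma perm_of_deck_eq_iff:
  assumes "\<pi> permutes {1..n}" "length xs = n"
  shows "perm_of_deck xs = \<pi> \<longleftrightarrow> xs = map \<pi> [1..<n + 1]"
proof
  assume "perm_of_deck xs = \<pi>"
  then show "xs = map \<pi> [1..<n + 1]"
    using assms(2) by (intro nth_equalityI) (auto simp: perm_of_deck_def simp del: upt_Suc)
next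
  assume "xs = map \<pi> [1..<n + 1]"
  then show "perm_of_deck xs = \<pi>"
    using permutes_not_in[OF assms(1)] by (auto simp: perm_of_deck_def fun_eq_iff simp del: upt_Suc)
qed

theorem theorem1p2:
  fixes n m :: nat and p q :: real and \<pi> :: "nat \<Rightarrow> nat"
  assumes "n \<ge> 1" and "m \<ge> 1"
    and "p \<in> {0<..<1}" and "q = 1 - p"
    and "\<pi> permutes {1..n}"
  shows "pmf (shelf_law n m p) \<pi> =
    1 / real m ^ n *
    (\<Sum>B \<in> valley_free n \<pi>.
      real (m choose (n - card B)) * p ^ card (Asc n \<pi> \<inter> B) * q ^ card (Des n \<pi> \<inter> B))"
proof -
  let ?D = "deal m p (rev [1..<n + 1]) (\<lambda>_. [])" and ?xs = "map \<pi> [1..<n + 1]"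
  have inj: "inj_on \<pi> {1..n}" using assms(5) by (rule permutes_inj_on)
  have "pmf (shelf_law n m p) \<pi> = measure ?D {F. perm_of_deck (join_piles m F) = \<pi>}"
    by (simp add: shelf_law_def shelf_shuffle_def pmf_map map_pmf_comp vimage_def del: upt_Suc)
  also have "\<dots> = measure ?D (splits m ?xs)"
  proof (rule measure_pmf.finite_measure_eq_AE)
    show "AE F in ?D. F \<in> {F. perm_of_deck (join_piles m F) = \<pi>} \<longleftrightarrow> F \<in> splits m ?xs"
    proof (rule AE_pmfI)
      fix F assume "F \<in> set_pmf ?D"
      from set_pmf_deal[OF assms(2) this]
      have "\<forall>s. s \<notin> {1..m} \<longrightarrow> F s = []" "length (join_piles m F) = n"
        by (simp_all add: length_join_piles del: upt_Suc)
      then show "F \<in> {F. perm_of_deck (join_piles m F) = \<pi>} \<longleftrightarrow> F \<in> splits m ?xs"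
        using perm_of_deck_eq_iff[OF assms(5), of "join_piles m F"] by (simp add: splits_def)
    qed
  qed simp_all
  also have "\<dots> = (\<Sum>F \<in> splits m ?xs. pmf ?D F)"
    by (rule measure_measure_pmf_finite) (rule finite_splits)
  also have "\<dots> = (\<Sum>F \<in> splits m ?xs. (1 / real m) ^ n * (\<Prod>s \<in> {1..m}. pile_weight p q (F s)))"
  proof (intro sum.cong refl)
    fix F assume F: "F \<in> splits m ?xs"
    have "image_mset \<pi> (mset_set {1..n}) = mset_set {1..n}"
      using assms(5) inj by (simp add: image_mset_mset_set permutes_image)
    then have "mset ?xs = mset (rev [1..<n + 1])"
      by (simp add: atLeastLessThanSuc_atLeastAtMost del: upt_Suc)
    moreover have "join_piles m F = ?xs" using F by (simp add: splits_def)
    ultimately have "(\<Sum>s \<in> {1..m}. mset (F s)) = mset (rev [1..<n + 1])"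
      by (simp only: mset_join_piles[symmetric])
    then show "pmf ?D F = (1 / real m) ^ n * (\<Prod>s \<in> {1..m}. pile_weight p q (F s))"
      using F assms(2-4) by (subst pmf_deal)
        (auto simp: splits_def sorted_wrt_rev simp del: upt_Suc)
  qed
  also have "\<dots> = (1 / real m) ^ n * (\<Sum>F \<in> splits m ?xs. \<Prod>s \<in> {1..m}. pile_weight p q (F s))"
    by (simp add: sum_distrib_left)
  also have "\<dots> = (1 / real m) ^ n *
      (\<Sum>B \<in> Pow {1..<n}. real (m choose (n - card B)) * link_weight n \<pi> p q B)"
    by (subst sum_splits_eq_sum_links[OF inj order_refl]) (rule refl)
  also have "(\<Sum>B \<in> Pow {1..<n}. real (m choose (n - card B)) * link_weight n \<pi> p q B) =
    (\<Sum>B \<in> valley_free n \<pi>.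
      real (m choose (n - card B)) * p ^ card (Asc n \<pi> \<inter> B) * q ^ card (Des n \<pi> \<inter> B))"
  proof (rule sum.mono_neutral_cong_right)
    have "{1..<n} = {1..n - 1}" using assms(1) by auto
    then show "valley_free n \<pi> \<subseteq> Pow {1..<n}"
      and "\<forall>B \<in> Pow {1..<n} - valley_free n \<pi>. real (m choose (n - card B)) * link_weight n \<pi> p q B = 0"
      by (auto simp: valley_free_def link_weight_def)
  qed (auto simp: valley_free_def link_weight_def)
  finally show ?thesis by (simp add: power_one_over)
qed

end
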